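(* Let $-1\le\alpha\le1$, $-1\le\beta\le1$ with $\alpha\beta\ne\pm1$, and let $0\le\gamma<1$. Let $$\mathfrak{L}_{\alpha,\beta,\gamma}(z)=\frac{(2-2\gamma)z}{(1-\alpha z)(1-\beta z)}\qquad(z\in\mathbb{D}).$$ Then $\mathfrak{L}_{\alpha,\beta,\gamma}$ maps $\mathbb{D}$ onto a domain $\mathfrak{D}(\alpha,\beta,\gamma)$ whose boundary is given by $$\partial\mathfrak{D}(\alpha,\beta,\gamma)=\left\{w=u+iv:\ \frac{\bigl(2(1-\gamma)u+(\alpha+\beta)(u^2+v^2)\bigr)^2}{(1+\alpha\beta)^2}+\frac{4(1-\gamma)^2v^2}{(1-\alpha\beta)^2}-(u^2+v^2)^2=0\right\},$$ and $\mathfrak{L}_{\alpha,\beta,\gamma}$ maps the unit circle onto the curve $$\frac{\bigl(2(1-\gamma)u+(\alpha+\beta)(u^2+v^2)\bigr)^2}{(1+\alpha\beta)^2}+\frac{4(1-\gamma)^2}{(1-\alpha\beta)^2}v^2=(u^2+v^2)^2,$$ or $$\left(u^2+v^2-\frac{2(1-\gamma)(\alpha+\beta)}{(1-\alpha^2)(1-\beta^2)}u\right)^2=\frac{4(1-\gamma)^2(1+\alpha\beta)^2}{(1-\alpha^2)^2(1-\beta^2)^2}u^2+\frac{4(1-\gamma)^2(1+\alpha\beta)^2}{(1-\alpha^2)(1-\beta^2)(1-\alpha\beta)^2}v^2.$$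
   Context: $\mathbb{D}=\{z\in\mathbb{C}:|z|<1\}$ is the open unit disk; $u$ and $v$ denote the real and imaginary parts of the complex number $w=u+iv$. The same formula defines $\mathfrak{L}_{\alpha,\beta,\gamma}$ on the unit circle. The curve is called a generalization of the Pascal snail (limaçon of Pascal).
   Formalization: The origin w=0, which solves all the equations but equals L(0), an interior point, is removed from each curve; poles on the unit circle (|α|=1 or |β|=1) are excluded; the second form is claimed only when α²≠1 and β²≠1, where it is defined. *)

theory Defs
  imports "HOL-Complex_Analysis.Complex_Analysis"
begin

definition snail_map :: "real \<Rightarrow> real \<Rightarrow> real \<Rightarrow> complex \<Rightarrow> complex" where
  "snail_map \<alpha> \<beta> \<gamma> z =
     of_real (2 - 2 * \<gamma>) * z / ((1 - of_real \<alpha> * z) * (1 - of_real \<beta> * z))"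

definition snail_domain :: "real \<Rightarrow> real \<Rightarrow> real \<Rightarrow> complex set" where
  "snail_domain \<alpha> \<beta> \<gamma> = snail_map \<alpha> \<beta> \<gamma> ` ball 0 1"

text \<open>
  If \<open>\<bar>\<alpha>\<bar> = 1\<close> or \<open>\<bar>\<beta>\<bar> = 1\<close>, the map has a pole on the unit circle, where HOL division would
  return the spurious value \<open>0\<close>. The poles are therefore removed; otherwise this is the whole
  unit circle.
\<close>

definition snail_circle :: "real \<Rightarrow> real \<Rightarrow> complex set" where
  "snail_circle \<alpha> \<beta> = {z \<in> sphere 0 1. of_real \<alpha> * z \<noteq> 1 \<and> of_real \<beta> * z \<noteq> 1}"

text \<open>
  The origin satisfies each of the quartic equations below (it is an isolated solution), but it is
  the image of \<open>0\<close>, hence an interior point of the domain and not the image of any point of the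
  unit circle. So the boundary curve is the solution set without the origin.
\<close>

definition snail_boundary_curve :: "real \<Rightarrow> real \<Rightarrow> real \<Rightarrow> complex set" where
  "snail_boundary_curve \<alpha> \<beta> \<gamma> =
     {w. \<exists>u v. w = Complex u v \<and>
        (2 * (1 - \<gamma>) * u + (\<alpha> + \<beta>) * (u\<^sup>2 + v\<^sup>2))\<^sup>2 / (1 + \<alpha> * \<beta>)\<^sup>2
        + 4 * (1 - \<gamma>)\<^sup>2 * v\<^sup>2 / (1 - \<alpha> * \<beta>)\<^sup>2 - (u\<^sup>2 + v\<^sup>2)\<^sup>2 = 0} - {0}"

definition snail_curve :: "real \<Rightarrow> real \<Rightarrow> real \<Rightarrow> complex set" where
  "snail_curve \<alpha> \<beta> \<gamma> =
     {w. \<exists>u v. w = Complex u v \<and>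
        (2 * (1 - \<gamma>) * u + (\<alpha> + \<beta>) * (u\<^sup>2 + v\<^sup>2))\<^sup>2 / (1 + \<alpha> * \<beta>)\<^sup>2
        + 4 * (1 - \<gamma>)\<^sup>2 / (1 - \<alpha> * \<beta>)\<^sup>2 * v\<^sup>2 = (u\<^sup>2 + v\<^sup>2)\<^sup>2} - {0}"

text \<open>The following form of the equation is meaningful only for \<open>\<alpha>\<^sup>2 \<noteq> 1\<close> and \<open>\<beta>\<^sup>2 \<noteq> 1\<close>.\<close>

definition snail_curve_alt :: "real \<Rightarrow> real \<Rightarrow> real \<Rightarrow> complex set" where
  "snail_curve_alt \<alpha> \<beta> \<gamma> =
     {w. \<exists>u v. w = Complex u v \<and>
        (u\<^sup>2 + v\<^sup>2 - 2 * (1 - \<gamma>) * (\<alpha> + \<beta>) / ((1 - \<alpha>\<^sup>2) * (1 - \<beta>\<^sup>2)) * u)\<^sup>2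
        = 4 * (1 - \<gamma>)\<^sup>2 * (1 + \<alpha> * \<beta>)\<^sup>2 / ((1 - \<alpha>\<^sup>2)\<^sup>2 * (1 - \<beta>\<^sup>2)\<^sup>2) * u\<^sup>2
        + 4 * (1 - \<gamma>)\<^sup>2 * (1 + \<alpha> * \<beta>)\<^sup>2
            / ((1 - \<alpha>\<^sup>2) * (1 - \<beta>\<^sup>2) * (1 - \<alpha> * \<beta>)\<^sup>2) * v\<^sup>2} - {0}"

end

theory Submission
  imports Defs
begin

text \<open>
  Put \<open>c = 2 - 2\<gamma> > 0\<close>. Everything follows from looking at the reciprocal of the map: for
  \<open>z \<noteq> 0\<close> away from the poles,
  \<open>c / w = 1/z + \<alpha>\<beta> z - (\<alpha> + \<beta>)\<close>, a translated Joukowski map.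

  On the unit circle \<open>1/z\<close> is the conjugate of \<open>z\<close>, so \<open>c / w\<close> has real part
  \<open>(1 + \<alpha>\<beta>) Re z - (\<alpha> + \<beta>)\<close> and imaginary part \<open>-(1 - \<alpha>\<beta>) Im z\<close>; as \<open>z\<close> runs over the circle
  it traces an ellipse with centre \<open>-(\<alpha> + \<beta>)\<close> and semi-axes \<open>1 + \<alpha>\<beta>\<close>, \<open>1 - \<alpha>\<beta>\<close>, both nonzero.
  The poles of the map correspond to the point \<open>0\<close> of that ellipse. Multiplying the equation of the
  ellipse by \<open>|w|\<^sup>4\<close> gives the quartic (\<open>snail_equation_iff_ellipse\<close>,
  \<open>snail_map_image_circle\<close>). The second form of the quartic arises by completing the square, since
  \<open>(1 + \<alpha>\<beta>)\<^sup>2 - (\<alpha> + \<beta>)\<^sup>2 = (1 - \<alpha>\<^sup>2)(1 - \<beta>\<^sup>2)\<close> (\<open>snail_equation_iff_alt\<close>).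

  For the frontier, the equality of two values at \<open>z\<close> and \<open>z'\<close> forces
  \<open>(z - z')(1 - \<alpha>\<beta> z z') = 0\<close>. Hence no value on the circle is also a value on the disk
  (\<open>snail_map_circle_notin_domain\<close>). By compactness of the closed disk, every point of the
  closure of the image is a value at a point of the closed disk other than a pole
  (\<open>closure_snail_domain\<close>). As the image is open by the open mapping theorem, its frontier is the
  image of the circle.
\<close>

section \<open>The map on the unit circle and the quartic\<close>

lemma snail_denominator_on_circle:
  fixes a b :: real and z :: complex
  assumes "norm z = 1"
  shows "(1 - of_real a * z) * (1 - of_real b * z) =
         z * Complex ((1 + a * b) * Re z - (a + b)) (- (1 - a * b) * Im z)"
proof -
  have "z * cnj z = 1"
    using assms by (simp add: complex_norm_square[symmetric])
  moreover have "Complex ((1 + a * b) * Re z - (a + b)) (- (1 - a * b) * Im z)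
      = cnj z + of_real (a * b) * z - of_real (a + b)"
    by (simp add: complex_eq_iff algebra_simps)
  moreover have "(1 - of_real a * z) * (1 - of_real b * z)
      = 1 + of_real (a * b) * z * z - of_real (a + b) * z"
    by (simp add: algebra_simps)
  ultimately show ?thesis
    by (simp add: ring_distribs mult_ac)
qed

lemma snail_map_on_circle:
  assumes "norm z = 1"
  shows "snail_map a b g z =
         of_real (2 * (1 - g)) / Complex ((1 + a * b) * Re z - (a + b)) (- (1 - a * b) * Im z)"
  using assms unfolding snail_map_def snail_denominator_on_circle[OF assms] by auto

text \<open>
  The quartic is the ellipse condition on \<open>c / w\<close> multiplied by \<open>|w|\<^sup>4\<close>, because
  \<open>c / w = c (u - i v) / |w|\<^sup>2\<close>.
\<close>

lemma snail_equation_iff_ellipse: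
  fixes c s p q u v :: real
  assumes "Complex u v \<noteq> 0"
  shows "(c * u + s * (u\<^sup>2 + v\<^sup>2))\<^sup>2 / p\<^sup>2 + c\<^sup>2 * v\<^sup>2 / q\<^sup>2 = (u\<^sup>2 + v\<^sup>2)\<^sup>2 \<longleftrightarrow>
         ((Re (of_real c / Complex u v) + s) / p)\<^sup>2 + (- Im (of_real c / Complex u v) / q)\<^sup>2 = 1"
proof -
  define r where "r = u\<^sup>2 + v\<^sup>2"
  have r: "r \<noteq> 0"
    using assms by (simp add: r_def complex_eq_iff sum_power2_eq_zero_iff)
  have re: "Re (of_real c / Complex u v) + s = (c * u + s * r) / r"
    using r by (simp add: Re_divide r_def[symmetric] field_simps)
  have im: "- Im (of_real c / Complex u v) = c * v / r"
    by (simp add: Im_divide r_def[symmetric])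
  have "((c * u + s * r) / r / p)\<^sup>2 + (c * v / r / q)\<^sup>2
      = ((c * u + s * r)\<^sup>2 / p\<^sup>2 + c\<^sup>2 * v\<^sup>2 / q\<^sup>2) / r\<^sup>2"
    unfolding power_divide power_mult_distrib by (simp add: add_divide_distrib mult.commute)
  then show ?thesis
    using r unfolding re im r_def[symmetric] by (auto simp: divide_eq_1_iff)
qed

lemma mem_snail_curve_iff:
  "w \<in> snail_curve a b g \<longleftrightarrow> w \<noteq> 0 \<and>
    ((Re (of_real (2 * (1 - g)) / w) + (a + b)) / (1 + a * b))\<^sup>2
    + (- Im (of_real (2 * (1 - g)) / w) / (1 - a * b))\<^sup>2 = 1"
proof (cases "w = 0")
  case False
  obtain u v where w: "w = Complex u v"
    by (cases w)
  have "w \<in> snail_curve a b g \<longleftrightarrow>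
      (2 * (1 - g) * u + (a + b) * (u\<^sup>2 + v\<^sup>2))\<^sup>2 / (1 + a * b)\<^sup>2
      + (2 * (1 - g))\<^sup>2 * v\<^sup>2 / (1 - a * b)\<^sup>2 = (u\<^sup>2 + v\<^sup>2)\<^sup>2"
    using False unfolding power_mult_distrib[of 2] by (simp add: snail_curve_def w)
  then show ?thesis
    using snail_equation_iff_ellipse[of u v "2 * (1 - g)" "a + b" "1 + a * b" "1 - a * b"] False
    by (simp add: w)
qed (simp add: snail_curve_def)

lemma snail_boundary_curve_eq: "snail_boundary_curve a b g = snail_curve a b g"
  by (simp add: snail_boundary_curve_def snail_curve_def)

lemma snail_map_image_circle:
  fixes a b g :: real
  assumes p: "a * b \<noteq> -1" and q: "a * b \<noteq> 1" and g: "g < 1"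
  shows "snail_map a b g ` snail_circle a b = snail_curve a b g"
proof (intro equalityI subsetI)
  have p0: "1 + a * b \<noteq> 0" and q0: "1 - a * b \<noteq> 0"
    using p q by auto
  define c where "c = complex_of_real (2 * (1 - g))"
  have c0: "c \<noteq> 0"
    using g unfolding c_def by (simp only: of_real_eq_0_iff) simp
  let ?E = "\<lambda>z. Complex ((1 + a * b) * Re z - (a + b)) (- (1 - a * b) * Im z)"
  {
    fix w assume "w \<in> snail_map a b g ` snail_circle a b"
    then obtain z where z: "norm z = 1" "of_real a * z \<noteq> 1" "of_real b * z \<noteq> 1"
      and w: "w = c / ?E z"
      by (auto simp: snail_circle_def snail_map_on_circle c_def)
    have "?E z \<noteq> 0"
      using snail_denominator_on_circle[OF z(1), of a b] z by auto
    then have "w \<noteq> 0" and cw: "c / w = ?E z"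
      using c0 by (auto simp: w)
    moreover have "(Re z)\<^sup>2 + (Im z)\<^sup>2 = 1"
      using z(1) by (simp add: cmod_def)
    moreover have "(Re (?E z) + (a + b)) / (1 + a * b) = Re z" "- Im (?E z) / (1 - a * b) = Im z"
      using p0 q0 by (simp_all add: field_simps)
    ultimately show "w \<in> snail_curve a b g"
      unfolding mem_snail_curve_iff c_def[symmetric] cw by simp
  next
    fix w assume "w \<in> snail_curve a b g"
    define W where "W = c / w"
    \<comment> \<open>The affine map from the circle to the ellipse, solved for the point of the circle.\<close>
    define z where "z = Complex ((Re W + (a + b)) / (1 + a * b)) (- Im W / (1 - a * b))"
    have "w \<noteq> 0" and "norm z = 1"
      using \<open>w \<in> snail_curve a b g\<close> unfolding mem_snail_curve_iff c_def[symmetric] W_def[symmetric]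
      by (simp_all add: z_def cmod_def)
    have E: "?E z = W"
      using p0 q0 by (simp add: z_def complex_eq_iff field_simps)
    have "W \<noteq> 0"
      using c0 \<open>w \<noteq> 0\<close> by (simp add: W_def)
    then have "of_real a * z \<noteq> 1" "of_real b * z \<noteq> 1"
      using snail_denominator_on_circle[OF \<open>norm z = 1\<close>, of a b] \<open>norm z = 1\<close> E by auto
    then have "z \<in> snail_circle a b"
      using \<open>norm z = 1\<close> by (simp add: snail_circle_def)
    moreover have "snail_map a b g z = w"
      using c0 \<open>w \<noteq> 0\<close>
      unfolding snail_map_on_circle[OF \<open>norm z = 1\<close>] E c_def[symmetric] W_def by simp
    ultimately show "w \<in> snail_map a b g ` snail_circle a b"
      by blast
  }
qed

text \<open>
  With \<open>D = p\<^sup>2 - s\<^sup>2\<close>, the difference of the two sides of the second equation is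
  \<open>-p\<^sup>2 / D\<close> times the difference of the two sides of the first.
\<close>

lemma snail_equation_iff_alt:
  fixes c s p q u v D :: real
  assumes D: "D = p\<^sup>2 - s\<^sup>2" "D \<noteq> 0" and "p \<noteq> 0"
  shows "(c * u + s * (u\<^sup>2 + v\<^sup>2))\<^sup>2 / p\<^sup>2 + c\<^sup>2 / q\<^sup>2 * v\<^sup>2 = (u\<^sup>2 + v\<^sup>2)\<^sup>2 \<longleftrightarrow>
         (u\<^sup>2 + v\<^sup>2 - c * s / D * u)\<^sup>2 = c\<^sup>2 * p\<^sup>2 / D\<^sup>2 * u\<^sup>2 + c\<^sup>2 * p\<^sup>2 / (D * q\<^sup>2) * v\<^sup>2"
proof -
  define r where "r = u\<^sup>2 + v\<^sup>2"
  define K where "K = c\<^sup>2 / q\<^sup>2 * v\<^sup>2"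
  have K: "c\<^sup>2 * p\<^sup>2 / (D * q\<^sup>2) * v\<^sup>2 = p\<^sup>2 * K / D"
    by (simp add: K_def mult_ac)
  have p2: "p\<^sup>2 = D + s\<^sup>2"
    using D by simp
  have r: "r - c * s / D * u = (D * r - c * s * u) / D"
    using D(2) by (simp add: diff_divide_distrib)
  have "(r - c * s / D * u)\<^sup>2 - (c\<^sup>2 * p\<^sup>2 / D\<^sup>2 * u\<^sup>2 + p\<^sup>2 * K / D)
      = ((D * r - c * s * u)\<^sup>2 - c\<^sup>2 * p\<^sup>2 * u\<^sup>2 - D * (p\<^sup>2 * K)) / D\<^sup>2"
    unfolding r power_divide using D(2) by (simp add: diff_divide_distrib power2_eq_square[of D])
  also have "(D * r - c * s * u)\<^sup>2 - c\<^sup>2 * p\<^sup>2 * u\<^sup>2 - D * (p\<^sup>2 * K)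
      = D * (p\<^sup>2 * r\<^sup>2 - (c * u + s * r)\<^sup>2 - p\<^sup>2 * K)"
    unfolding p2 by (simp add: algebra_simps power2_eq_square)
  also have "\<dots> / D\<^sup>2 = (p\<^sup>2 * r\<^sup>2 - (c * u + s * r)\<^sup>2 - p\<^sup>2 * K) / D"
    using D(2) by (simp add: power2_eq_square[of D])
  also have "p\<^sup>2 * r\<^sup>2 - (c * u + s * r)\<^sup>2 - p\<^sup>2 * K
      = - (p\<^sup>2 * ((c * u + s * r)\<^sup>2 / p\<^sup>2 + K - r\<^sup>2))"
    using \<open>p \<noteq> 0\<close> by (simp add: algebra_simps)
  also have "\<dots> / D = - (p\<^sup>2 / D) * ((c * u + s * r)\<^sup>2 / p\<^sup>2 + K - r\<^sup>2)"
    by simp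
  finally have *: "(r - c * s / D * u)\<^sup>2 - (c\<^sup>2 * p\<^sup>2 / D\<^sup>2 * u\<^sup>2 + p\<^sup>2 * K / D)
      = - (p\<^sup>2 / D) * ((c * u + s * r)\<^sup>2 / p\<^sup>2 + K - r\<^sup>2)" .
  have "- (p\<^sup>2 / D) \<noteq> 0"
    using assms(2,3) by simp
  then have "(r - c * s / D * u)\<^sup>2 - (c\<^sup>2 * p\<^sup>2 / D\<^sup>2 * u\<^sup>2 + p\<^sup>2 * K / D) = 0 \<longleftrightarrow>
      (c * u + s * r)\<^sup>2 / p\<^sup>2 + K - r\<^sup>2 = 0"
    unfolding * mult_eq_0_iff by blast
  then show ?thesis
    unfolding r_def[symmetric] K K_def[symmetric] by linarith
qed

lemma snail_curve_alt_eq: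
  fixes a b g :: real
  assumes "a\<^sup>2 \<noteq> 1" "b\<^sup>2 \<noteq> 1" "a * b \<noteq> -1"
  shows "snail_curve_alt a b g = snail_curve a b g"
proof -
  have D: "(1 - a\<^sup>2) * (1 - b\<^sup>2) = (1 + a * b)\<^sup>2 - (a + b)\<^sup>2"
    by (simp add: power2_eq_square algebra_simps)
  have D0: "(1 - a\<^sup>2) * (1 - b\<^sup>2) \<noteq> 0" and p0: "1 + a * b \<noteq> 0"
    using assms by auto
  have c: "4 * (1 - g)\<^sup>2 = (2 * (1 - g))\<^sup>2"
    unfolding power_mult_distrib by simp
  show ?thesis
    unfolding snail_curve_alt_def snail_curve_def c power_mult_distrib[of "1 - a\<^sup>2", symmetric]
      snail_equation_iff_alt[OF D D0 p0] ..
qed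

section \<open>The image of the disk and its frontier\<close>

lemma snail_denominator_nonzero_on_ball:
  fixes a :: real and z :: complex
  assumes "\<bar>a\<bar> \<le> 1" "norm z < 1"
  shows "of_real a * z \<noteq> 1"
proof
  assume "of_real a * z = 1"
  then have "\<bar>a\<bar> * norm z = 1"
    by (metis norm_mult norm_of_real norm_one)
  moreover have "\<bar>a\<bar> * norm z \<le> norm z"
    using assms(1) by (simp add: mult_left_le_one_le)
  ultimately show False
    using assms(2) by simp
qed

text \<open>
  Clearing denominators in \<open>snail_map a b g z = snail_map a b g z'\<close> gives
  \<open>(z - z') (1 - a b z z') = 0\<close>, and the second factor is nonzero because \<open>|a b z z'| < 1\<close>. This
  also covers univalence on the disk.
\<close>

lemma snail_map_inj_cball_ball:
  fixes a b g :: real and z z' :: complex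
  assumes a: "\<bar>a\<bar> \<le> 1" and b: "\<bar>b\<bar> \<le> 1" and g: "g < 1"
    and z: "norm z \<le> 1" "of_real a * z \<noteq> 1" "of_real b * z \<noteq> 1" and z': "norm z' < 1"
    and eq: "snail_map a b g z = snail_map a b g z'"
  shows "z = z'"
proof -
  have nz': "of_real a * z' \<noteq> 1" "of_real b * z' \<noteq> 1"
    using snail_denominator_nonzero_on_ball a b z' by auto
  have "complex_of_real (2 - 2 * g) \<noteq> 0"
    using g by (simp only: of_real_eq_0_iff)
  then have "z * ((1 - of_real a * z') * (1 - of_real b * z'))
      = z' * ((1 - of_real a * z) * (1 - of_real b * z))"
    using eq z(2,3) nz' by (simp add: snail_map_def frac_eq_eq del: of_real_diff of_real_mult)
  then have "(z - z') * (1 - of_real (a * b) * (z * z')) = 0"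
    by (simp add: algebra_simps)
  moreover have "of_real (a * b) * (z * z') \<noteq> 1"
  proof (rule snail_denominator_nonzero_on_ball)
    show "\<bar>a * b\<bar> \<le> 1"
      using a b by (simp add: abs_mult mult_le_one)
    have "norm (z * z') \<le> norm z'"
      using z(1) by (simp add: norm_mult mult_left_le_one_le)
    then show "norm (z * z') < 1"
      using z' by simp
  qed
  ultimately show ?thesis
    by simp
qed

lemma snail_map_circle_notin_domain:
  fixes a b g :: real
  assumes "\<bar>a\<bar> \<le> 1" "\<bar>b\<bar> \<le> 1" "g < 1" and z: "z \<in> snail_circle a b"
  shows "snail_map a b g z \<notin> snail_domain a b g"
proof
  assume "snail_map a b g z \<in> snail_domain a b g"
  then obtain z' where "norm z' < 1" "snail_map a b g z = snail_map a b g z'"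
    by (auto simp: snail_domain_def)
  then have "z = z'"
    using assms by (elim snail_map_inj_cball_ball[rotated -1]) (auto simp: snail_circle_def)
  then show False
    using z \<open>norm z' < 1\<close> by (simp add: snail_circle_def)
qed

lemma snail_map_holomorphic_on_ball:
  fixes a b g :: real
  assumes "\<bar>a\<bar> \<le> 1" "\<bar>b\<bar> \<le> 1"
  shows "snail_map a b g holomorphic_on ball 0 1"
  unfolding snail_map_def[abs_def]
  using snail_denominator_nonzero_on_ball[OF assms(1)] snail_denominator_nonzero_on_ball[OF assms(2)]
  by (intro holomorphic_intros) auto

lemma open_snail_domain:
  fixes a b g :: real
  assumes ab: "\<bar>a\<bar> \<le> 1" "\<bar>b\<bar> \<le> 1" and g: "g < 1"
  shows "open (snail_domain a b g)"
  unfolding snail_domain_def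
proof (rule open_mapping_thm3[OF snail_map_holomorphic_on_ball[OF ab] open_ball])
  show "inj_on (snail_map a b g) (ball 0 1)"
  proof (rule inj_onI)
    fix z z' :: complex
    assume z: "z \<in> ball 0 1" and z': "z' \<in> ball 0 1"
      and eq: "snail_map a b g z = snail_map a b g z'"
    have "norm z < 1" "norm z' < 1"
      using z z' by auto
    then show "z = z'"
      by (intro snail_map_inj_cball_ball[OF ab g _ _ _ _ eq] less_imp_le
          snail_denominator_nonzero_on_ball[OF ab(1)] snail_denominator_nonzero_on_ball[OF ab(2)])
  qed
qed

text \<open>
  Closedness is checked on the equation \<open>w (1 - a z) (1 - b z) = c z\<close> with cleared denominators,
  which survives passage to a limit of points \<open>z\<close> of the disk. It excludes the poles as well: at a
  pole it would give \<open>z = 0\<close>, which is not a pole.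
\<close>

lemma closure_snail_domain:
  fixes a b g :: real
  assumes ab: "\<bar>a\<bar> \<le> 1" "\<bar>b\<bar> \<le> 1" and g: "g < 1"
  shows "closure (snail_domain a b g) = snail_domain a b g \<union> snail_map a b g ` snail_circle a b"
proof (intro equalityI subsetI)
  fix w assume "w \<in> closure (snail_domain a b g)"
  then obtain W where W: "\<And>n. W n \<in> snail_domain a b g" "W \<longlonglongrightarrow> w"
    unfolding closure_sequential by blast
  define c where "c = complex_of_real (2 - 2 * g)"
  have c0: "c \<noteq> 0"
    using g unfolding c_def by (simp only: of_real_eq_0_iff)
  have "\<exists>z. norm z < 1 \<and> W n = snail_map a b g z" for n
    using W(1)[of n] by (auto simp: snail_domain_def)
  then obtain Z where Z: "\<And>n. norm (Z n) < 1" "\<And>n. W n = snail_map a b g (Z n)"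
    by metis
  have eqn: "W n * ((1 - of_real a * Z n) * (1 - of_real b * Z n)) = c * Z n" for n
    using snail_denominator_nonzero_on_ball[OF ab(1) Z(1)[of n]]
      snail_denominator_nonzero_on_ball[OF ab(2) Z(1)[of n]]
    by (simp add: Z(2) snail_map_def c_def)
  have "\<forall>n. Z n \<in> cball 0 1"
    using Z(1) by (simp add: less_imp_le)
  then obtain z r where z: "z \<in> cball 0 1" "strict_mono (r :: nat \<Rightarrow> nat)" "(Z \<circ> r) \<longlonglongrightarrow> z"
    using compact_cball[of "0 :: complex" 1] unfolding compact_def by meson
  have Zr: "(\<lambda>n. Z (r n)) \<longlonglongrightarrow> z" and Wr: "(\<lambda>n. W (r n)) \<longlonglongrightarrow> w"
    using z(3) LIMSEQ_subseq_LIMSEQ[OF W(2) z(2)] by (simp_all add: o_def)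
  have "(\<lambda>n. W (r n) * ((1 - of_real a * Z (r n)) * (1 - of_real b * Z (r n))))
      \<longlonglongrightarrow> w * ((1 - of_real a * z) * (1 - of_real b * z))"
    by (intro tendsto_intros Zr Wr)
  moreover have "(\<lambda>n. c * Z (r n)) \<longlonglongrightarrow> c * z"
    by (intro tendsto_intros Zr)
  ultimately have lim: "w * ((1 - of_real a * z) * (1 - of_real b * z)) = c * z"
    unfolding eqn by (rule LIMSEQ_unique)
  have nz: "of_real a * z \<noteq> 1" "of_real b * z \<noteq> 1"
    using lim c0 by auto
  then have w: "w = snail_map a b g z"
    using lim unfolding snail_map_def c_def[symmetric] by (simp add: eq_divide_eq)
  show "w \<in> snail_domain a b g \<union> snail_map a b g ` snail_circle a b"
  proof (cases "norm z < 1")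
    case True
    then show ?thesis
      by (auto simp: w snail_domain_def)
  next
    case False
    then have "z \<in> snail_circle a b"
      using z(1) nz by (simp add: snail_circle_def)
    then show ?thesis
      by (simp add: w)
  qed
next
  fix w assume "w \<in> snail_domain a b g \<union> snail_map a b g ` snail_circle a b"
  then show "w \<in> closure (snail_domain a b g)"
  proof
    assume "w \<in> snail_domain a b g"
    then show ?thesis
      using closure_subset by blast
  next
    assume "w \<in> snail_map a b g ` snail_circle a b"
    then obtain z where z: "norm z = 1" "of_real a * z \<noteq> 1" "of_real b * z \<noteq> 1"
      and w: "w = snail_map a b g z"
      by (auto simp: snail_circle_def)
    have cont: "isCont (snail_map a b g) z"
      unfolding snail_map_def[abs_def] using z(2,3) by (intro continuous_intros) auto
    have "z \<in> closure (ball 0 1)"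
      using z(1) by simp
    then obtain Z where "\<And>n. Z n \<in> ball 0 1" and Z: "Z \<longlonglongrightarrow> z"
      unfolding closure_sequential by blast
    have "(\<lambda>n. snail_map a b g (Z n)) \<longlonglongrightarrow> w"
      unfolding w by (rule isCont_tendsto_compose[OF cont Z])
    moreover have "snail_map a b g (Z n) \<in> snail_domain a b g" for n
      unfolding snail_domain_def using \<open>Z n \<in> ball 0 1\<close> by (rule imageI)
    ultimately show ?thesis
      unfolding closure_sequential by (intro exI[of _ "\<lambda>n. snail_map a b g (Z n)"] conjI allI)
  qed
qed

lemma frontier_snail_domain:
  fixes a b g :: real
  assumes "\<bar>a\<bar> \<le> 1" "\<bar>b\<bar> \<le> 1" "g < 1"
  shows "frontier (snail_domain a b g) = snail_map a b g ` snail_circle a b"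
  unfolding frontier_def closure_snail_domain[OF assms] interior_open[OF open_snail_domain[OF assms]]
  using snail_map_circle_notin_domain[OF assms] by blast

theorem mainTheorem1:
  fixes \<alpha> \<beta> \<gamma> :: real
  assumes "-1 \<le> \<alpha>" "\<alpha> \<le> 1" "-1 \<le> \<beta>" "\<beta> \<le> 1"
    and "\<alpha> * \<beta> \<noteq> 1" "\<alpha> * \<beta> \<noteq> -1"
    and "0 \<le> \<gamma>" "\<gamma> < 1"
  shows "open (snail_domain \<alpha> \<beta> \<gamma>) \<and> connected (snail_domain \<alpha> \<beta> \<gamma>) \<and> snail_domain \<alpha> \<beta> \<gamma> \<noteq> {}
    \<and> frontier (snail_domain \<alpha> \<beta> \<gamma>) = snail_boundary_curve \<alpha> \<beta> \<gamma>
    \<and> snail_map \<alpha> \<beta> \<gamma> ` snail_circle \<alpha> \<beta> = snail_curve \<alpha> \<beta> \<gamma>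
    \<and> (\<alpha>\<^sup>2 \<noteq> 1 \<and> \<beta>\<^sup>2 \<noteq> 1 \<longrightarrow>
         snail_map \<alpha> \<beta> \<gamma> ` snail_circle \<alpha> \<beta> = snail_curve_alt \<alpha> \<beta> \<gamma>)"
proof -
  have ab: "\<bar>\<alpha>\<bar> \<le> 1" "\<bar>\<beta>\<bar> \<le> 1"
    using assms by auto
  have circle: "snail_map \<alpha> \<beta> \<gamma> ` snail_circle \<alpha> \<beta> = snail_curve \<alpha> \<beta> \<gamma>"
    using assms by (intro snail_map_image_circle)
  have "connected (snail_domain \<alpha> \<beta> \<gamma>)"
    unfolding snail_domain_def
    by (intro connected_continuous_image connected_ball holomorphic_on_imp_continuous_on
        snail_map_holomorphic_on_ball ab)
  moreover have "snail_domain \<alpha> \<beta> \<gamma> \<noteq> {}"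
    by (simp add: snail_domain_def)
  ultimately show ?thesis
    using open_snail_domain[OF ab] frontier_snail_domain[OF ab] circle assms
    by (simp add: snail_boundary_curve_eq snail_curve_alt_eq)
qed

end
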